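(* Let $A\in\mathbb R^{n\times d}$. The rows of $A$ can be uniquely partitioned into matrices $(A_S,A_c)$, with a corresponding pair of orthogonal subspaces $(S,S^\perp)$ where $S=\operatorname{span}(A_S^\top)$ is the span of the rows of $A_S$, satisfying the following properties. 1. (Strongly convex part.) If $\ell$ is twice continuously differentiable with $\ell''>0$, and $\ell\ge0$, and $\lim_{z\to-\infty}\ell(z)=0$, then $L\circ A$ is strongly convex over compact subsets of $S$, and $L\circ A_S$ admits a unique minimizer $\bar v$ (over $S$), with $$\inf_{w\in\mathbb R^d}L(Aw)=\inf_{v\in S}L(A_Sv)=L(A_S\bar v).$$ 2. (Separable part.) If $A_c$ is nonempty (and thus so is $A_\perp$), then $A_\perp$ is linearly separable. The maximum margin is given by $$\gamma:=-\min\Big\{\max_i(A_\perp u)_i:|u|=1\Big\}=\min\Big\{|A_\perp^\top q|:q\ge0,\ \sum_iq_i=1\Big\}>0,$$ and the maximum margin solution $\bar u$ is the unique optimum of the primal problem (the first minimization), satisfying $\bar u=-A_\perp^\top\bar q/\gamma$ for every dual optimum $\bar q$ (optimum of the second minimization). If $\ell\ge0$ and $\lim_{z\to-\infty}\ell(z)=0$, then $$\inf_{w\in\mathbb R^d}L(Aw)=L(A_S\bar v)+\lim_{r\to\infty}L\big(A_c(\bar v+r\bar u)\big)=L(A_S\bar v).$$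
   Context: $|\cdot|$ is the Euclidean norm. $A$ is the data matrix with rows $A_i=-y_ix_i^\top$ for examples $(x_i,y_i)$, normalized so that $\max_i|A_i|\le1$. $\ell:\mathbb R\to\mathbb R_{\ge0}$ is a loss function, and for a vector $v\in\mathbb R^k$ of any dimension $k$, $L(v)=\sum_{i=1}^k\ell(v_i)$. $A_\perp$ is the matrix whose rows are the orthogonal projections onto $S^\perp$ of the rows of $A_c$; it is linearly separable if there is $u$ with $A_\perp u<0$ coordinate-wise. The vector $\bar v$ in item 2 is the minimizer of $L\circ A_S$ over $S$ from item 1. *)

theory Defs
  imports "HOL-Analysis.Analysis"
begin

text \<open>
  A submatrix of \<^term>\<open>A :: real^'d^'n\<close> formed by some of its rows is represented by the set
  \<^term>\<open>I :: 'n set\<close> of the indices of these rows (possibly empty); a vector of dimension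
  \<^term>\<open>card I\<close> is given by the coordinates in \<^term>\<open>I\<close> of a vector in \<^typ>\<open>real^'n\<close>.
  With this convention, \<^term>\<open>A *v w\<close> restricted to \<^term>\<open>I\<close> is the product of the submatrix
  with \<^term>\<open>w\<close>.
\<close>

definition loss_sum :: "(real \<Rightarrow> real) \<Rightarrow> 'n::finite set \<Rightarrow> real^'n \<Rightarrow> real"
  where "loss_sum l I v = (\<Sum>i\<in>I. l (v $ i))"

definition row_span :: "real^'d^'n \<Rightarrow> 'n set \<Rightarrow> (real^'d) set"
  where "row_span A I = span ((\<lambda>i. row i A) ` I)"

definition orth_proj :: "'a::euclidean_space set \<Rightarrow> 'a \<Rightarrow> 'a"
  where "orth_proj T x = (THE p. p \<in> T \<and> (\<forall>y\<in>T. orthogonal (x - p) y))"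

text \<open>
  \<open>A\<^sub>\<bottom>\<close> consists of the rows of \<open>A_perp A I\<close> with index outside \<open>I\<close>; the remaining rows are
  zero and are never referred to.
\<close>

definition A_perp :: "real^'d^'n \<Rightarrow> 'n set \<Rightarrow> real^'d^'n"
  where "A_perp A I = (\<chi> i. orth_proj ((row_span A I)\<^sup>\<bottom>) (row i A))"

definition max_coord :: "'n::finite set \<Rightarrow> real^'n \<Rightarrow> real"
  where "max_coord J v = Max ((\<lambda>i. v $ i) ` J)"

text \<open>
  The vectors in the probability simplex over the coordinates in \<open>J\<close>, padded with zeros, so that
  \<^term>\<open>transpose B *v q\<close> only involves the rows of \<^term>\<open>B\<close> with index in \<open>J\<close>.
\<close>

definition prob_simplex :: "'n::finite set \<Rightarrow> (real^'n) set"
  where "prob_simplex J =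
    {q. (\<forall>i\<in>J. 0 \<le> q $ i) \<and> (\<forall>i. i \<notin> J \<longrightarrow> q $ i = 0) \<and> (\<Sum>i\<in>J. q $ i) = 1}"

definition unique_arg_min :: "('a \<Rightarrow> real) \<Rightarrow> ('a \<Rightarrow> bool) \<Rightarrow> 'a \<Rightarrow> bool"
  where "unique_arg_min f P x \<longleftrightarrow> is_arg_min f P x \<and> (\<forall>y. is_arg_min f P y \<longrightarrow> y = x)"

text \<open>
  The set \<open>D\<close> need not be convex: the inequality is required for all segments with endpoints in
  \<open>D\<close>, where \<open>f\<close> is defined on the whole space.
\<close>

definition strongly_convex_over :: "'a::real_normed_vector set \<Rightarrow> ('a \<Rightarrow> real) \<Rightarrow> bool"
  where "strongly_convex_over D f \<longleftrightarrow>
    (\<exists>\<mu>>0. \<forall>x\<in>D. \<forall>y\<in>D. \<forall>t\<in>{0..1}.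
      f ((1 - t) *\<^sub>R x + t *\<^sub>R y)
        \<le> (1 - t) * f x + t * f y - \<mu> / 2 * t * (1 - t) * (norm (x - y))\<^sup>2)"

definition twice_continuously_differentiable :: "(real \<Rightarrow> real) \<Rightarrow> bool"
  where "twice_continuously_differentiable l \<longleftrightarrow>
    (\<forall>z. l field_differentiable at z) \<and> (\<forall>z. deriv l field_differentiable at z) \<and>
    continuous_on UNIV (deriv (deriv l))"

end

theory Submission
  imports Defs
begin

text \<open>
  \<open>J\<close> must consist of the rows \<open>i\<close> for which some \<open>u\<close> satisfies \<open>A u \<le> 0\<close> and \<open>(A u)\<^sub>i < 0\<close>.
  Adding up such directions gives one \<open>u \<in> S\<^sup>\<bottom>\<close> that is strictly decreasing on all of \<open>J\<close>: it
  separates \<open>A\<^sub>\<bottom>\<close> and drives the loss on \<open>J\<close> to zero without changing the loss on \<open>I\<close>.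
  By maximality of \<open>J\<close>, every nonzero \<open>v \<in> S\<close> increases some row in \<open>I\<close>, so the loss on \<open>I\<close> is
  coercive over \<open>S\<close> and has a minimizer. The margin statement is about the point closest to the
  origin in the convex hull of the rows of \<open>A\<^sub>\<bottom>\<close>. Conversely, for any admissible partition a
  separator of \<open>A\<^sub>\<bottom>\<close>, projected to \<open>S\<^sup>\<bottom>\<close>, shows that the rows in \<open>J\<close> are of the above kind,
  while a row of that kind in \<open>I\<close> would yield a direction strictly decreasing the exponential
  loss on \<open>I\<close>, which then has no minimizer.
\<close>

section \<open>Orthogonal projections and row spans\<close>

lemma matrix_vector_row: "(A *v u) $ i = row i A \<bullet> u"
  for A :: "real^'d^'n"
  by (simp add: matrix_vector_mul_component row_def)

text \<open>Existence comes from the orthogonal decomposition along \<open>T\<close>. The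
  description by \<open>THE\<close> is justified because the difference of two candidates lies in
  \<open>T\<close> and is orthogonal to itself.\<close>

lemma orth_proj:
  assumes "subspace T"
  shows "orth_proj T x \<in> T" and "\<And>y. y \<in> T \<Longrightarrow> orth_proj T x \<bullet> y = x \<bullet> y"
proof -
  obtain p z where pz: "p \<in> span T" "\<And>w. w \<in> span T \<Longrightarrow> orthogonal z w" "x = p + z"
    using orthogonal_subspace_decomp_exists [of T x] by metis
  have T: "span T = T"
    using assms by (simp add: span_eq_iff)
  have "orth_proj T x = p"
    unfolding orth_proj_def
  proof (rule the_equality)
    show "p \<in> T \<and> (\<forall>y\<in>T. orthogonal (x - p) y)"
      using pz T by simp
  next
    fix q assume q: "q \<in> T \<and> (\<forall>y\<in>T. orthogonal (x - q) y)"
    then have "p - q \<in> T"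
      using pz T assms by (simp add: subspace_diff)
    then have "(p - q) \<bullet> (p - q) = 0"
      using q pz T by (auto simp: orthogonal_def inner_diff_left algebra_simps)
    then show "q = p"
      by simp
  qed
  then show "orth_proj T x \<in> T" and "\<And>y. y \<in> T \<Longrightarrow> orth_proj T x \<bullet> y = x \<bullet> y"
    using pz T by (auto simp: orthogonal_def inner_add_left)
qed

lemma subspace_row_span: "subspace (row_span A I)"
  by (simp add: row_span_def)

lemma row_in_row_span: "i \<in> I \<Longrightarrow> row i A \<in> row_span A I"
  by (auto simp: row_span_def intro: span_base)

lemma row_span_comp_iff:
  fixes A :: "real^'d^'n"
  shows "u \<in> (row_span A I)\<^sup>\<bottom> \<longleftrightarrow> (\<forall>i\<in>I. (A *v u) $ i = 0)"
proof
  assume "u \<in> (row_span A I)\<^sup>\<bottom>"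
  then show "\<forall>i\<in>I. (A *v u) $ i = 0"
    by (auto simp: orthogonal_comp_def orthogonal_def matrix_vector_row row_in_row_span)
next
  assume u: "\<forall>i\<in>I. (A *v u) $ i = 0"
  have "orthogonal u a" if "a \<in> row_span A I" for a
    using that [unfolded row_span_def] u
    by (intro orthogonal_to_span [of a]) (auto simp: orthogonal_def matrix_vector_row inner_commute)
  then show "u \<in> (row_span A I)\<^sup>\<bottom>"
    by (simp add: orthogonal_comp_def orthogonal_commute)
qed

text \<open>Such a \<open>v\<close> lies both in the span and in its orthogonal complement. This
  injectivity on the span is what makes strong convexity possible there.\<close>

lemma row_span_eq_0:
  fixes A :: "real^'d^'n"
  assumes "v \<in> row_span A I" and "\<And>i. i \<in> I \<Longrightarrow> (A *v v) $ i = 0"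
  shows "v = 0"
proof -
  have "v \<in> (row_span A I)\<^sup>\<bottom>"
    using assms(2) by (simp add: row_span_comp_iff)
  then show ?thesis
    using assms(1) by (auto simp: orthogonal_comp_def orthogonal_def)
qed

text \<open>The part of \<open>w\<close> removed by projecting onto the span is orthogonal to all
  rows in \<open>I\<close>. Minimizing the loss on \<open>I\<close> over the whole space thereby
  reduces to minimizing it over the span.\<close>

lemma row_span_component:
  fixes A :: "real^'d^'n"
  obtains v where "v \<in> row_span A I" and "\<And>i. i \<in> I \<Longrightarrow> (A *v v) $ i = (A *v w) $ i"
proof
  show "orth_proj (row_span A I) w \<in> row_span A I"
    by (simp add: orth_proj subspace_row_span)
  show "(A *v orth_proj (row_span A I) w) $ i = (A *v w) $ i" if "i \<in> I" for i
    using orth_proj(2) [OF subspace_row_span row_in_row_span [OF that]]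
    by (simp add: matrix_vector_row inner_commute)
qed

text \<open>A row and its projection onto the complement have the same inner products with vectors
  of the complement, so strict signs transfer between \<open>A_perp\<close> and \<open>A\<close>
  there.\<close>

lemma A_perp_mult:
  fixes A :: "real^'d^'n"
  assumes "u \<in> (row_span A I)\<^sup>\<bottom>"
  shows "(A_perp A I *v u) $ i = (A *v u) $ i"
proof -
  have "row i (A_perp A I) = orth_proj ((row_span A I)\<^sup>\<bottom>) (row i A)"
    by (simp add: A_perp_def row_def)
  then show ?thesis
    using assms by (simp add: matrix_vector_row orth_proj subspace_orthogonal_comp)
qed

text \<open>The rows of \<open>A_perp\<close> lie in the complement, so any separator can be moved
  into it by projection.\<close>

lemma A_perp_mult_orth_proj:
  fixes A :: "real^'d^'n"
  shows "(A_perp A I *v orth_proj ((row_span A I)\<^sup>\<bottom>) u) $ i = (A_perp A I *v u) $ i"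
proof -
  have "row i (A_perp A I) \<in> (row_span A I)\<^sup>\<bottom>"
    by (simp add: A_perp_def row_def orth_proj subspace_orthogonal_comp)
  then show ?thesis
    using orth_proj(2) [OF subspace_orthogonal_comp, of _ "row_span A I" u]
    by (simp add: matrix_vector_row inner_commute [of "row i (A_perp A I)"])
qed

text \<open>The product is a combination of rows of \<open>A_perp\<close>. This places the maximum
  margin solution in the complement.\<close>

lemma transpose_A_perp_mult:
  fixes A :: "real^'d^'n"
  shows "transpose (A_perp A I) *v q \<in> (row_span A I)\<^sup>\<bottom>"
proof -
  have "transpose (A_perp A I) *v q = (\<Sum>i\<in>UNIV. q $ i *\<^sub>R row i (A_perp A I))"
    by (simp add: matrix_mult_sum scalar_mult_eq_scaleR del: transpose_matrix_vector)
  then show ?thesis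
    by (auto intro!: subspace_sum subspace_scale orth_proj(1) subspace_orthogonal_comp
        simp: A_perp_def row_def)
qed

section \<open>The probability simplex and max-margin duality\<close>

lemma prob_simplex_axis: "j \<in> J \<Longrightarrow> axis j 1 \<in> prob_simplex J"
  by (auto simp: prob_simplex_def axis_def)

text \<open>A weighted mean does not exceed a common bound of its entries; this is the source of
  weak duality.\<close>

lemma prob_simplex_inner_le:
  assumes "q \<in> prob_simplex J" and "\<And>i. i \<in> J \<Longrightarrow> v $ i \<le> c"
  shows "q \<bullet> v \<le> c"
proof -
  have "q \<bullet> v = (\<Sum>i\<in>J. q $ i * v $ i)"
    using assms(1) by (auto simp: inner_vec_def prob_simplex_def intro!: sum.mono_neutral_right)
  also have "\<dots> \<le> (\<Sum>i\<in>J. q $ i * c)"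
    using assms by (intro sum_mono mult_left_mono) (auto simp: prob_simplex_def)
  also have "\<dots> = c"
    using assms(1) by (simp add: prob_simplex_def flip: sum_distrib_right)
  finally show ?thesis .
qed

lemma convex_prob_simplex: "convex (prob_simplex J)"
  by (auto simp: convex_def prob_simplex_def sum.distrib simp flip: sum_distrib_left)

lemma compact_prob_simplex: "compact (prob_simplex J)"
proof -
  have "prob_simplex J \<subseteq> cbox 0 (\<chi> i. 1)"
  proof
    fix q assume q: "q \<in> prob_simplex J"
    have "q $ i \<le> 1" if "i \<in> J" for i
      using q member_le_sum [of i J "($) q"] that by (auto simp: prob_simplex_def)
    then show "q \<in> cbox 0 (\<chi> i. 1)"
      using q by (auto simp: mem_box_cart prob_simplex_def) (metis zero_le_one)+
  qed
  moreover have "closed (prob_simplex J)"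
    unfolding prob_simplex_def Ball_def
    by (intro closed_Collect_conj closed_Collect_all closed_Collect_imp
        closed_Collect_le closed_Collect_eq open_Collect_const continuous_intros)
  ultimately show ?thesis
    using bounded_subset [OF bounded_cbox] by (auto simp: compact_eq_bounded_closed)
qed

lemma max_coord_le_iff:
  "J \<noteq> {} \<Longrightarrow> max_coord J v \<le> c \<longleftrightarrow> (\<forall>i\<in>J. v $ i \<le> c)"
  by (simp add: max_coord_def)

text \<open>Let \<open>p\<close> be the point closest to the origin in the convex hull
  \<open>C\<close> of the rows in \<open>J\<close>. Weak duality and Cauchy-Schwarz give the lower
  bound \<open>- norm p\<close> for the primal objective at every unit vector, and the normalized
  \<open>- p\<close> attains it.\<close>

lemma max_margin_duality:
  fixes B :: "real^'d^'n"
  assumes "J \<noteq> {}" and sep: "\<And>i. i \<in> J \<Longrightarrow> (B *v u) $ i < 0"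
  defines "dual \<equiv> is_arg_min (\<lambda>q. norm (transpose B *v q)) (\<lambda>q. q \<in> prob_simplex J)"
  obtains \<gamma> ubar where "\<gamma> > 0" and "\<exists>q. dual q"
    and "unique_arg_min (\<lambda>u. max_coord J (B *v u)) (\<lambda>u. norm u = 1) ubar"
    and "\<gamma> = - max_coord J (B *v ubar)"
    and "\<And>q. dual q \<Longrightarrow> norm (transpose B *v q) = \<gamma>"
    and "\<And>q. dual q \<Longrightarrow> ubar = - ((1 / \<gamma>) *\<^sub>R (transpose B *v q))"
proof -
  define C where "C = (\<lambda>q. transpose B *v q) ` prob_simplex J"
  have inner: "(transpose B *v q) \<bullet> w = q \<bullet> (B *v w)" for q w
    by (simp add: dot_lmul_matrix)
  have "convex C"
    unfolding C_def by (intro convex_linear_image convex_prob_simplex) simp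
  have "closed C"
    unfolding C_def
    by (intro compact_imp_closed compact_continuous_image compact_prob_simplex
        linear_continuous_on matrix_vector_mul_bounded_linear)
  have "C \<noteq> {}"
    using \<open>J \<noteq> {}\<close> prob_simplex_axis by (auto simp: C_def)
  then obtain p where "p \<in> C" and p: "\<And>y. y \<in> C \<Longrightarrow> dist 0 p \<le> dist 0 y"
    using distance_attains_inf [OF \<open>closed C\<close>] by metis
  \<comment> \<open>The closest point of a closed convex set is unique, so all dual optima share the
    image \<open>p\<close> even if they differ.\<close>
  have dual: "dual q \<longleftrightarrow> q \<in> prob_simplex J \<and> transpose B *v q = p" for q
  proof
    assume q: "dual q"
    then have "transpose B *v q = p"
      by (intro any_closest_point_unique [OF \<open>convex C\<close> \<open>closed C\<close>, where a = 0])
        (use \<open>p \<in> C\<close> p in \<open>auto simp: dual_def C_def is_arg_min_def not_less\<close>)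
    then show "q \<in> prob_simplex J \<and> transpose B *v q = p"
      using q by (simp add: dual_def is_arg_min_def)
  qed (use p in \<open>auto simp: dual_def C_def is_arg_min_def not_less\<close>)
  obtain q0 where q0: "q0 \<in> prob_simplex J" "transpose B *v q0 = p"
    using \<open>p \<in> C\<close> by (auto simp: C_def)
  \<comment> \<open>A simplex point mapped to 0 would average the strictly negative coordinates of
    \<open>B *v u\<close> in \<open>J\<close> to 0.\<close>
  have "p \<noteq> 0"
  proof
    assume "p = 0"
    have "max_coord J (B *v u) < 0"
      using \<open>J \<noteq> {}\<close> sep by (simp add: max_coord_def)
    moreover have "q0 \<bullet> (B *v u) \<le> max_coord J (B *v u)"
      using \<open>J \<noteq> {}\<close> by (intro prob_simplex_inner_le [OF q0(1)]) (simp add: max_coord_def)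
    moreover have "q0 \<bullet> (B *v u) = 0"
      using inner [of q0 u] q0(2) \<open>p = 0\<close> by simp
    ultimately show False
      by simp
  qed
  define ubar where "ubar = - ((1 / norm p) *\<^sub>R p)"
  have upper: "max_coord J (B *v ubar) \<le> - norm p"
    unfolding max_coord_le_iff [OF \<open>J \<noteq> {}\<close>]
  proof
    fix j assume "j \<in> J"
    let ?r = "transpose B *v axis j 1"
    \<comment> \<open>\<open>?r\<close> is row \<open>j\<close> of \<open>B\<close>, hence a point
      of \<open>C\<close>; this is the variational inequality for the closest point
      \<open>p\<close>.\<close>
    have "(0 - p) \<bullet> (?r - p) \<le> 0"
      by (rule any_closest_point_dot [OF \<open>convex C\<close> \<open>closed C\<close> \<open>p \<in> C\<close>])
        (use p prob_simplex_axis [OF \<open>j \<in> J\<close>] in \<open>auto simp: C_def\<close>)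
    then have "(norm p)\<^sup>2 \<le> ?r \<bullet> p"
      by (simp add: inner_diff_right power2_norm_eq_inner inner_commute)
    then have "norm p \<le> ?r \<bullet> p / norm p"
      using \<open>p \<noteq> 0\<close> by (simp add: pos_le_divide_eq power2_eq_square)
    moreover have "(B *v ubar) $ j = - (?r \<bullet> p / norm p)"
    proof -
      have "(B *v ubar) $ j = ?r \<bullet> ubar"
        unfolding inner by (simp add: inner_axis' )
      then show ?thesis
        by (simp add: ubar_def)
    qed
    ultimately show "(B *v ubar) $ j \<le> - norm p"
      by simp
  qed
  have weak: "p \<bullet> w \<le> max_coord J (B *v w)" for w
    using prob_simplex_inner_le [OF q0(1), of "B *v w" "max_coord J (B *v w)"] \<open>J \<noteq> {}\<close>
      inner [of q0 w] q0(2) by (simp add: max_coord_def)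
  have lower: "- norm p \<le> p \<bullet> w" if "norm w = 1" for w
    using Cauchy_Schwarz_ineq2 [of p w] that by simp
  have [simp]: "norm ubar = 1"
    using \<open>p \<noteq> 0\<close> by (simp add: ubar_def)
  have margin: "max_coord J (B *v ubar) = - norm p"
    using upper weak [of ubar] lower [of ubar] by simp
  show ?thesis
  proof
    show "norm p > 0" and "\<exists>q. dual q" and "norm p = - max_coord J (B *v ubar)"
      using \<open>p \<noteq> 0\<close> q0 dual margin by auto
    show "norm (transpose B *v q) = norm p" if "dual q" for q
      using that dual by simp
    show "ubar = - ((1 / norm p) *\<^sub>R (transpose B *v q))" if "dual q" for q
      using that dual by (simp add: ubar_def)
    show "unique_arg_min (\<lambda>u. max_coord J (B *v u)) (\<lambda>u. norm u = 1) ubar"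
      unfolding unique_arg_min_def
    proof (intro conjI allI impI)
      show "is_arg_min (\<lambda>u. max_coord J (B *v u)) (\<lambda>u. norm u = 1) ubar"
        using margin order_trans [OF lower weak] by (auto simp: is_arg_min_def not_less)
      fix w assume w: "is_arg_min (\<lambda>u. max_coord J (B *v u)) (\<lambda>u. norm u = 1) w"
      then have "norm w = 1" and "max_coord J (B *v w) \<le> - norm p"
        using margin \<open>norm ubar = 1\<close> unfolding is_arg_min_def not_less by (metis not_less)+
      then have "p \<bullet> w = - norm p"
        using weak [of w] lower [of w] by simp
      \<comment> \<open>Equality in Cauchy-Schwarz forces \<open>w\<close> to be a positive multiple
        of \<open>- p\<close>.\<close>
      then have "(- p) \<bullet> w = norm (- p) * norm w"
        using \<open>norm w = 1\<close> by simp
      then have "norm p *\<^sub>R w = - p"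
        using norm_cauchy_schwarz_eq [of "- p" w] \<open>norm w = 1\<close> by simp
      then have "(1 / norm p) *\<^sub>R (norm p *\<^sub>R w) = (1 / norm p) *\<^sub>R (- p)"
        by simp
      then show "w = ubar"
        using \<open>p \<noteq> 0\<close> by (simp add: ubar_def)
    qed
  qed
qed

section \<open>Strong convexity of the loss\<close>

text \<open>The modulus is the minimum of the second derivative on \<open>{-R..R}\<close>, which is
  attained by compactness and hence positive.\<close>

lemma strongly_convex_on_interval:
  assumes "twice_continuously_differentiable l" and "\<And>z. deriv (deriv l) z > 0" and "R \<ge> 0"
  obtains m where "m > 0"
    and "\<And>x y t. \<lbrakk>\<bar>x\<bar> \<le> R; \<bar>y\<bar> \<le> R; 0 \<le> t; t \<le> 1\<rbrakk> \<Longrightarrow>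
      l ((1 - t) * x + t * y) \<le> (1 - t) * l x + t * l y - m / 2 * t * (1 - t) * (x - y)\<^sup>2"
proof -
  have d1: "(l has_real_derivative deriv l z) (at z)"
    and d2: "(deriv l has_real_derivative deriv (deriv l) z) (at z)" for z
    using assms(1) by (auto simp: twice_continuously_differentiable_def DERIV_deriv_iff_field_differentiable)
  have "continuous_on {-R..R} (deriv (deriv l))"
    using assms(1) continuous_on_subset
    by (auto simp: twice_continuously_differentiable_def)
  then obtain c where c: "\<And>z. z \<in> {-R..R} \<Longrightarrow> deriv (deriv l) c \<le> deriv (deriv l) z"
    using continuous_attains_inf [of "{-R..R}" "deriv (deriv l)"] \<open>R \<ge> 0\<close>
    by (auto simp del: atLeastAtMost_iff)
  \<comment> \<open>Strong convexity with modulus \<open>m\<close> is convexity after subtracting \<open>m / 2 * z\<^sup>2\<close>.\<close>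
  define m where "m = deriv (deriv l) c"
  have conv: "convex_on {-R..R} (\<lambda>z. l z - m / 2 * z\<^sup>2)"
  proof (rule f''_ge0_imp_convex)
    show "((\<lambda>z. l z - m / 2 * z\<^sup>2) has_real_derivative deriv l z - m * z) (at z)" for z
      by (auto intro!: derivative_eq_intros d1)
    show "((\<lambda>z. deriv l z - m * z) has_real_derivative deriv (deriv l) z - m) (at z)" for z
      by (auto intro!: derivative_eq_intros d2)
  qed (use c in \<open>auto simp: m_def\<close>)
  show ?thesis
  proof
    show "m > 0"
      using assms(2) by (simp add: m_def)
    fix x y t :: real
    assume "\<bar>x\<bar> \<le> R" "\<bar>y\<bar> \<le> R" "0 \<le> t" "t \<le> 1"
    then have "l ((1 - t) * x + t * y) - m / 2 * ((1 - t) * x + t * y)\<^sup>2 \<le>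
        (1 - t) * (l x - m / 2 * x\<^sup>2) + t * (l y - m / 2 * y\<^sup>2)"
      using convex_onD [OF conv, of t x y] by (simp add: abs_le_iff)
    also have "\<dots> = (1 - t) * l x + t * l y - m / 2 * t * (1 - t) * (x - y)\<^sup>2
        - m / 2 * ((1 - t) * x + t * y)\<^sup>2"
      by (simp add: field_simps power2_eq_square)
    finally show "l ((1 - t) * x + t * y) \<le> (1 - t) * l x + t * l y - m / 2 * t * (1 - t) * (x - y)\<^sup>2"
      by simp
  qed
qed

text \<open>Compactness of \<open>D\<close> confines all coordinates of \<open>A *v v\<close> to one
  interval, where \<open>l\<close> has modulus \<open>m\<close>. Injectivity on \<open>S\<close>
  gives a factor \<open>e\<close> with \<open>e * norm v\<close> at most the norm of the image,
  which turns \<open>m\<close> into the modulus \<open>m * e\<^sup>2\<close> in terms of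
  \<open>v\<close>.\<close>

lemma strongly_convex_loss_sum:
  fixes A :: "real^'d^'n"
  assumes "twice_continuously_differentiable l" and "\<And>z. deriv (deriv l) z > 0"
    and "subspace S" and inj: "\<And>v. \<lbrakk>v \<in> S; \<And>i. i \<in> K \<Longrightarrow> (A *v v) $ i = 0\<rbrakk> \<Longrightarrow> v = 0"
    and "compact D" and "D \<subseteq> S"
  shows "strongly_convex_over D (\<lambda>w. loss_sum l K (A *v w))"
proof -
  \<comment> \<open>Coordinates outside \<open>K\<close> are set to zero so that the squared norm of
    \<open>P v\<close> is the sum over \<open>K\<close>.\<close>
  define P where "P v = (\<chi> i. if i \<in> K then (A *v v) $ i else 0)" for v
  have "linear P"
    by (rule linearI) (auto simp: P_def vec_eq_iff matrix_vector_right_distrib matrix_vector_mult_scaleR)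
  then have "bounded_linear P"
    by (rule linear_conv_bounded_linear [THEN iffD1])
  have "P v = 0 \<longrightarrow> v = 0" if "v \<in> S" for v
    using inj [OF that] by (auto simp: P_def vec_eq_iff split: if_splits)
  then obtain e where "e > 0" and e: "\<And>v. v \<in> S \<Longrightarrow> e * norm v \<le> norm (P v)"
    using injective_imp_isometric [OF closed_subspace [OF \<open>subspace S\<close>] \<open>subspace S\<close>
        \<open>bounded_linear P\<close>] by (auto simp: mult.commute)
  have sq: "(norm (P v))\<^sup>2 = (\<Sum>i\<in>K. ((A *v v) $ i)\<^sup>2)" for v
    unfolding power2_norm_eq_inner inner_vec_def P_def
    by (rule sum.mono_neutral_cong_right) (auto simp: power2_eq_square)
  have "bounded ((\<lambda>v. A *v v) ` D)"
    using \<open>compact D\<close> compact_imp_bounded bounded_linear_image matrix_vector_mul_bounded_linear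
    by blast
  then obtain R where "R > 0" and R: "\<And>v. v \<in> D \<Longrightarrow> norm (A *v v) \<le> R"
    by (auto simp: bounded_pos)
  have R': "\<bar>(A *v v) $ i\<bar> \<le> R" if "v \<in> D" for v i
    using R [OF that] component_le_norm_cart order_trans by blast
  obtain m where "m > 0" and m: "\<And>x y t. \<lbrakk>\<bar>x\<bar> \<le> R; \<bar>y\<bar> \<le> R; 0 \<le> t; t \<le> 1\<rbrakk> \<Longrightarrow>
      l ((1 - t) * x + t * y) \<le> (1 - t) * l x + t * l y - m / 2 * t * (1 - t) * (x - y)\<^sup>2"
    using strongly_convex_on_interval [OF assms(1,2)] \<open>R > 0\<close> by (metis less_imp_le)
  have "loss_sum l K (A *v ((1 - t) *\<^sub>R x + t *\<^sub>R y))
      \<le> (1 - t) * loss_sum l K (A *v x) + t * loss_sum l K (A *v y)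
        - (m * e\<^sup>2) / 2 * t * (1 - t) * (norm (x - y))\<^sup>2"
    if "x \<in> D" "y \<in> D" "t \<in> {0..1}" for x y t
  proof -
    have "loss_sum l K (A *v ((1 - t) *\<^sub>R x + t *\<^sub>R y))
        = (\<Sum>i\<in>K. l ((1 - t) * (A *v x) $ i + t * (A *v y) $ i))"
      by (simp add: loss_sum_def matrix_vector_right_distrib matrix_vector_mult_scaleR)
    also have "\<dots> \<le> (\<Sum>i\<in>K. (1 - t) * l ((A *v x) $ i) + t * l ((A *v y) $ i)
        - m / 2 * t * (1 - t) * ((A *v (x - y)) $ i)\<^sup>2)"
      using that R' by (intro sum_mono order_trans [OF m]) (auto simp: matrix_vector_mult_diff_distrib)
    also have "\<dots> = (1 - t) * loss_sum l K (A *v x) + t * loss_sum l K (A *v y)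
        - m / 2 * t * (1 - t) * (norm (P (x - y)))\<^sup>2"
      by (simp add: loss_sum_def sq sum_subtractf sum.distrib sum_distrib_left)
    also have "\<dots> \<le> (1 - t) * loss_sum l K (A *v x) + t * loss_sum l K (A *v y)
        - m / 2 * t * (1 - t) * (e * norm (x - y))\<^sup>2"
    proof -
      have "x - y \<in> S"
        using that \<open>D \<subseteq> S\<close> \<open>subspace S\<close> by (auto intro: subspace_diff)
      then have "(e * norm (x - y))\<^sup>2 \<le> (norm (P (x - y)))\<^sup>2"
        using e \<open>e > 0\<close> by (intro power_mono) auto
      then show ?thesis
        using \<open>m > 0\<close> that by (intro diff_left_mono mult_left_mono) auto
    qed
    finally show ?thesis
      by (simp add: power_mult_distrib mult_ac)
  qed
  then show ?thesis
    unfolding strongly_convex_over_def using \<open>m > 0\<close> \<open>e > 0\<close> by (intro exI [of _ "m * e\<^sup>2"]) auto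
qed

section \<open>Existence and uniqueness of the minimizer over the span\<close>

text \<open>The bound is the tangent at 1. Its slope is positive because the slope at 0 is
  nonnegative and the derivative is strictly increasing.\<close>

lemma loss_affine_lower_bound:
  fixes l :: "real \<Rightarrow> real"
  assumes "twice_continuously_differentiable l" and "\<And>z. deriv (deriv l) z > 0"
    and nonneg: "\<And>z. l z \<ge> 0" and "(l \<longlongrightarrow> 0) at_bot"
  obtains \<alpha> \<beta> where "\<alpha> > 0" and "\<beta> \<ge> 0" and "\<And>z. \<alpha> * z - \<beta> \<le> l z"
proof -
  have d1: "(l has_real_derivative deriv l z) (at z)"
    and d2: "(deriv l has_real_derivative deriv (deriv l) z) (at z)" for z
    using assms(1)
    by (auto simp: twice_continuously_differentiable_def DERIV_deriv_iff_field_differentiable)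
  have "convex_on UNIV l"
    using assms(2) by (intro f''_ge0_imp_convex [OF _ d1 d2]) (auto intro: less_imp_le)
  then have tangent: "deriv l c * (z - c) \<le> l z - l c" for z c
    by (rule convex_on_imp_above_tangent) (auto simp: d1)
  have "deriv l 0 \<ge> 0"
  proof (rule ccontr)
    assume neg: "\<not> deriv l 0 \<ge> 0"
    \<comment> \<open>With a negative slope at 0, the tangent at 0 is at least 1 for all
      \<open>z \<le> 1 / deriv l 0\<close>, against the limit 0.\<close>
    have "\<forall>\<^sub>F z in at_bot. l z < 1 \<and> z \<le> 1 / deriv l 0"
      using order_tendstoD(2) [OF assms(4), of 1] eventually_le_at_bot
      by (auto intro: eventually_conj)
    then obtain z where "l z < 1" and "z \<le> 1 / deriv l 0"
      using eventually_happens' [OF trivial_limit_at_bot_linorder] by blast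
    moreover have "deriv l 0 * z \<ge> 1"
      using \<open>z \<le> 1 / deriv l 0\<close> neg by (simp add: field_simps)
    ultimately show False
      using tangent [of 0 z] nonneg [of 0] by simp
  qed
  moreover have "deriv l 0 < deriv l 1"
    by (rule DERIV_pos_imp_increasing [of 0 1 "deriv l", OF zero_less_one])
      (use d2 assms(2) in blast)
  ultimately have pos: "deriv l 1 > 0"
    by simp
  show ?thesis
  proof
    show "deriv l 1 * z - deriv l 1 \<le> l z" for z
      using tangent [of 1 z] nonneg [of 1] by (simp add: algebra_simps)
  qed (use pos in auto)
qed

text \<open>Both sides are positively homogeneous, so \<open>c\<close> can be the minimum of the
  right-hand side over the unit sphere of \<open>S\<close>. If that sphere is empty,
  \<open>S\<close> is trivial and \<open>c = 1\<close> serves.\<close>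

lemma sum_positive_part_lower_bound:
  fixes A :: "real^'d^'n"
  assumes "subspace S" and pos: "\<And>v. \<lbrakk>v \<in> S; v \<noteq> 0\<rbrakk> \<Longrightarrow> \<exists>i\<in>I. (A *v v) $ i > 0"
  obtains c where "c > 0" and "\<And>v. v \<in> S \<Longrightarrow> c * norm v \<le> (\<Sum>i\<in>I. max 0 ((A *v v) $ i))"
proof (cases "S \<inter> sphere 0 1 = {}")
  case True
  have "v = 0" if "v \<in> S" for v
  proof (rule ccontr)
    assume "v \<noteq> 0"
    then have "(1 / norm v) *\<^sub>R v \<in> S \<inter> sphere 0 1"
      using that \<open>subspace S\<close> by (simp add: subspace_scale)
    then show False
      using True by blast
  qed
  then show ?thesis
    by (intro that [of 1]) (use sum_nonneg in fastforce)+
next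
  case False
  define f where "f v = (\<Sum>i\<in>I. max 0 ((A *v v) $ i))" for v
  have "continuous_on (S \<inter> sphere 0 1) f"
    unfolding f_def matrix_vector_row by (intro continuous_intros)
  moreover have "compact (S \<inter> sphere 0 1)"
    by (simp add: closed_Int_compact closed_subspace \<open>subspace S\<close>)
  ultimately obtain x where x: "x \<in> S \<inter> sphere 0 1" and
    min: "\<And>y. y \<in> S \<inter> sphere 0 1 \<Longrightarrow> f x \<le> f y"
    using continuous_attains_inf [of "S \<inter> sphere 0 1" f] False by metis
  show ?thesis
  proof
    have "x \<in> S" and "x \<noteq> 0"
      using x by auto
    then obtain i where "i \<in> I" "(A *v x) $ i > 0"
      using pos by blast
    then show "f x > 0"
      unfolding f_def by (intro sum_pos2 [of _ i]) auto
    show "f x * norm v \<le> (\<Sum>i\<in>I. max 0 ((A *v v) $ i))" if "v \<in> S" for v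
    proof (cases "v = 0")
      case False
      have "f x * norm v \<le> f ((1 / norm v) *\<^sub>R v) * norm v"
        using that False \<open>subspace S\<close> by (intro mult_right_mono min) (auto simp: subspace_scale)
      also have "\<dots> = f v"
        using False unfolding f_def sum_distrib_right
        by (intro sum.cong) (auto simp: matrix_vector_mult_scaleR max_def field_simps)
      finally show ?thesis
        by (simp add: f_def)
    qed (simp add: sum_nonneg)
  qed
qed

lemma loss_sum_nonneg: "(\<And>z. l z \<ge> 0) \<Longrightarrow> loss_sum l K v \<ge> 0"
  by (simp add: loss_sum_def sum_nonneg)

text \<open>The affine bound controls positive coordinates and nonnegativity of \<open>l\<close> the
  others, so the objective grows at least linearly in \<open>norm v\<close> over
  \<open>S\<close>.\<close>

lemma loss_sum_has_minimizer:
  fixes A :: "real^'d^'n"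
  assumes "twice_continuously_differentiable l" and "\<And>z. deriv (deriv l) z > 0"
    and nonneg: "\<And>z. l z \<ge> 0" and "(l \<longlongrightarrow> 0) at_bot"
    and "subspace S" and "\<And>v. \<lbrakk>v \<in> S; v \<noteq> 0\<rbrakk> \<Longrightarrow> \<exists>i\<in>I. (A *v v) $ i > 0"
  shows "\<exists>vbar. is_arg_min (\<lambda>v. loss_sum l I (A *v v)) (\<lambda>v. v \<in> S) vbar"
proof -
  define g where "g v = loss_sum l I (A *v v)" for v
  obtain \<alpha> \<beta> where "\<alpha> > 0" "\<beta> \<ge> 0" and lower: "\<And>z. \<alpha> * z - \<beta> \<le> l z"
    using loss_affine_lower_bound [OF assms(1-4)] by metis
  obtain c where "c > 0" and c: "\<And>v. v \<in> S \<Longrightarrow> c * norm v \<le> (\<Sum>i\<in>I. max 0 ((A *v v) $ i))"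
    using sum_positive_part_lower_bound [OF assms(5,6)] by metis
  have bound: "\<alpha> * c * norm v \<le> g v + card I * \<beta>" if "v \<in> S" for v
  proof -
    have "\<alpha> * c * norm v \<le> \<alpha> * (\<Sum>i\<in>I. max 0 ((A *v v) $ i))"
      using c [OF that] \<open>\<alpha> > 0\<close> by simp
    also have "\<dots> \<le> (\<Sum>i\<in>I. l ((A *v v) $ i) + \<beta>)"
      unfolding sum_distrib_left
    proof (rule sum_mono)
      fix i
      show "\<alpha> * max 0 ((A *v v) $ i) \<le> l ((A *v v) $ i) + \<beta>"
        using lower [of "(A *v v) $ i"] nonneg [of "(A *v v) $ i"] \<open>\<beta> \<ge> 0\<close> by (auto simp: max_def)
    qed
    finally show ?thesis
      by (simp add: g_def loss_sum_def sum.distrib)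
  qed
  have "continuous_on UNIV l"
    using assms(1) unfolding twice_continuously_differentiable_def
    by (metis continuous_at_imp_continuous_on field_differentiable_imp_continuous_at)
  then have cont: "continuous_on UNIV g"
    unfolding g_def loss_sum_def matrix_vector_row
    by (intro continuous_on_sum continuous_on_compose2 [OF \<open>continuous_on UNIV l\<close>]
        continuous_on_inner continuous_on_const continuous_on_id) auto
  \<comment> \<open>This sublevel set is compact and contains 0, and points of \<open>S\<close>
    outside it have values above \<open>g 0\<close>.\<close>
  define K where "K = S \<inter> {v. g v \<le> g 0}"
  have "norm v \<le> (g 0 + card I * \<beta>) / (\<alpha> * c)" if "v \<in> K" for v
    using bound [of v] that \<open>\<alpha> > 0\<close> \<open>c > 0\<close> by (auto simp: K_def field_simps)
  then have "bounded K"
    by (auto simp: bounded_iff)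
  moreover have "closed K"
    unfolding K_def using \<open>subspace S\<close> cont
    by (intro closed_Int closed_subspace closed_Collect_le continuous_intros)
  moreover have "0 \<in> K"
    using \<open>subspace S\<close> by (simp add: K_def subspace_0)
  ultimately obtain x where "x \<in> K" and x: "\<And>y. y \<in> K \<Longrightarrow> g x \<le> g y"
    using continuous_attains_inf [of K g] continuous_on_subset [OF cont]
    by (metis compact_eq_bounded_closed empty_iff subset_UNIV)
  have "g x \<le> g y" if "y \<in> S" for y
    using x [of y] x [OF \<open>0 \<in> K\<close>] that by (cases "g y \<le> g 0") (auto simp: K_def)
  then show ?thesis
    using \<open>x \<in> K\<close> unfolding g_def K_def by (auto simp: is_arg_min_def not_less)
qed

text \<open>Strong convexity over the two-point set of minimizers, evaluated at the midpoint, would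
  otherwise give a smaller value.\<close>

lemma loss_sum_minimizer_unique:
  fixes A :: "real^'d^'n"
  assumes "twice_continuously_differentiable l" and "\<And>z. deriv (deriv l) z > 0"
    and "is_arg_min (\<lambda>v. loss_sum l I (A *v v)) (\<lambda>v. v \<in> row_span A I) x"
    and "is_arg_min (\<lambda>v. loss_sum l I (A *v v)) (\<lambda>v. v \<in> row_span A I) y"
  shows "x = y"
proof -
  define g where "g v = loss_sum l I (A *v v)" for v
  have xy: "x \<in> row_span A I" "y \<in> row_span A I"
    and min: "\<And>v. v \<in> row_span A I \<Longrightarrow> g x \<le> g v" "g x = g y"
    using assms(3,4) by (auto simp: is_arg_min_def g_def not_less intro: antisym)
  have "strongly_convex_over {x, y} g"
    unfolding g_def using xy
    by (intro strongly_convex_loss_sum [OF assms(1,2) subspace_row_span] row_span_eq_0) auto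
  then obtain \<mu> where "\<mu> > 0" and \<mu>: "\<And>t. t \<in> {0..1} \<Longrightarrow> g ((1 - t) *\<^sub>R x + t *\<^sub>R y)
      \<le> (1 - t) * g x + t * g y - \<mu> / 2 * t * (1 - t) * (norm (x - y))\<^sup>2"
    unfolding strongly_convex_over_def by blast
  have "(1 - 1/2) *\<^sub>R x + (1/2) *\<^sub>R y \<in> row_span A I"
    using xy by (intro subspace_add subspace_scale subspace_row_span)
  from min(1) [OF this] \<mu> [of "1/2"] min(2) have "\<mu> * (norm (x - y))\<^sup>2 \<le> 0"
    by simp
  then show ?thesis
    using \<open>\<mu> > 0\<close> by (simp add: mult_le_0_iff)
qed

section \<open>The loss along a separating direction and its infimum\<close>

lemma matrix_vector_line_at_bot:
  fixes A :: "real^'d^'n"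
  assumes "(A *v u) $ i < 0"
  shows "filterlim (\<lambda>r. (A *v (v + r *\<^sub>R u)) $ i) at_bot at_top"
proof -
  have "filterlim (\<lambda>r. - (A *v v) $ i + - (A *v u) $ i * r) at_top at_top"
    using assms
    by (intro filterlim_tendsto_add_at_top [OF tendsto_const]
        filterlim_tendsto_pos_mult_at_top [OF tendsto_const]) (auto simp: filterlim_ident)
  then show ?thesis
    by (subst filterlim_uminus_at_bot)
      (simp add: matrix_vector_right_distrib matrix_vector_mult_scaleR mult.commute)
qed

lemma loss_sum_line_tendsto_0:
  fixes A :: "real^'d^'n"
  assumes "(l \<longlongrightarrow> 0) at_bot" and "\<And>i. i \<in> J \<Longrightarrow> (A *v u) $ i < 0"
  shows "((\<lambda>r. loss_sum l J (A *v (v + r *\<^sub>R u))) \<longlongrightarrow> 0) at_top"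
  unfolding loss_sum_def
  by (rule tendsto_null_sum)
    (rule filterlim_compose [OF assms(1) matrix_vector_line_at_bot [OF assms(2)]])

lemma INF_loss_sum_row_span:
  assumes "is_arg_min (\<lambda>v. loss_sum l I (A *v v)) (\<lambda>v. v \<in> row_span A I) vbar"
  shows "(INF v\<in>row_span A I. loss_sum l I (A *v v)) = loss_sum l I (A *v vbar)"
  using assms by (intro cInf_eq_minimum) (auto simp: is_arg_min_def not_less)

text \<open>From below, the loss outside \<open>I\<close> is dropped and \<open>w\<close> is
  replaced by its component in the span. From above, moving from \<open>vbar\<close> along
  \<open>u\<close> keeps the loss on \<open>I\<close> and sends the rest to 0.\<close>

lemma INF_loss_sum_UNIV:
  fixes A :: "real^'d^'n"
  assumes nonneg: "\<And>z. l z \<ge> 0" and "(l \<longlongrightarrow> 0) at_bot"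
    and u: "\<And>i. i \<in> I \<Longrightarrow> (A *v u) $ i = 0" "\<And>i. i \<in> - I \<Longrightarrow> (A *v u) $ i < 0"
    and min: "is_arg_min (\<lambda>v. loss_sum l I (A *v v)) (\<lambda>v. v \<in> row_span A I) vbar"
  shows "(INF w. loss_sum l UNIV (A *v w)) = loss_sum l I (A *v vbar)"
proof (rule antisym)
  have split: "loss_sum l UNIV v = loss_sum l I v + loss_sum l (- I) v" for v
    unfolding loss_sum_def by (subst sum.union_disjoint [symmetric]) auto
  show "loss_sum l I (A *v vbar) \<le> (INF w. loss_sum l UNIV (A *v w))"
  proof (rule cINF_greatest)
    fix w
    obtain v where v: "v \<in> row_span A I" "\<And>i. i \<in> I \<Longrightarrow> (A *v v) $ i = (A *v w) $ i"
      using row_span_component by metis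
    then have "loss_sum l I (A *v vbar) \<le> loss_sum l I (A *v v)"
      using min by (auto simp: is_arg_min_def not_less)
    also have "\<dots> = loss_sum l I (A *v w)"
      using v by (simp add: loss_sum_def)
    also have "\<dots> \<le> loss_sum l UNIV (A *v w)"
      using loss_sum_nonneg [OF nonneg] by (simp add: split)
    finally show "loss_sum l I (A *v vbar) \<le> loss_sum l UNIV (A *v w)" .
  qed simp
  have "((\<lambda>r. loss_sum l I (A *v vbar) + loss_sum l (- I) (A *v (vbar + r *\<^sub>R u)))
      \<longlongrightarrow> loss_sum l I (A *v vbar) + 0) at_top"
    using assms(2) u(2) by (intro tendsto_add tendsto_const loss_sum_line_tendsto_0)
  then have lim: "((\<lambda>r. loss_sum l I (A *v vbar) + loss_sum l (- I) (A *v (vbar + r *\<^sub>R u)))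
      \<longlongrightarrow> loss_sum l I (A *v vbar)) at_top"
    by simp
  have "(INF w. loss_sum l UNIV (A *v w))
      \<le> loss_sum l I (A *v vbar) + loss_sum l (- I) (A *v (vbar + r *\<^sub>R u))" for r
  proof -
    have "(INF w. loss_sum l UNIV (A *v w)) \<le> loss_sum l UNIV (A *v (vbar + r *\<^sub>R u))"
      by (intro cINF_lower bdd_belowI2 [of _ 0] loss_sum_nonneg nonneg) simp
    also have "loss_sum l I (A *v (vbar + r *\<^sub>R u)) = loss_sum l I (A *v vbar)"
      using u(1) by (simp add: loss_sum_def matrix_vector_right_distrib matrix_vector_mult_scaleR)
    then have "loss_sum l UNIV (A *v (vbar + r *\<^sub>R u)) =
        loss_sum l I (A *v vbar) + loss_sum l (- I) (A *v (vbar + r *\<^sub>R u))"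
      by (simp add: split)
    finally show ?thesis .
  qed
  then show "(INF w. loss_sum l UNIV (A *v w)) \<le> loss_sum l I (A *v vbar)"
    by (intro tendsto_lowerbound [OF lim]) auto
qed

section \<open>The separable rows and uniqueness of the partition\<close>

text \<open>This describes the only possible \<open>J\<close> without reference to a
  partition.\<close>

definition separable_rows :: "real^'d^'n \<Rightarrow> 'n set"
  where "separable_rows A = {i. \<exists>u. (\<forall>k. (A *v u) $ k \<le> 0) \<and> (A *v u) $ i < 0}"

lemma separable_rows_direction:
  fixes A :: "real^'d^'n"
  obtains u where "\<And>i. i \<in> separable_rows A \<Longrightarrow> (A *v u) $ i < 0"
    and "\<And>i. i \<notin> separable_rows A \<Longrightarrow> (A *v u) $ i = 0"
proof -
  have "\<forall>i\<in>separable_rows A. \<exists>u. (\<forall>k. (A *v u) $ k \<le> 0) \<and> (A *v u) $ i < 0"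
    by (simp add: separable_rows_def)
  then obtain f where f: "\<And>i k. i \<in> separable_rows A \<Longrightarrow> (A *v f i) $ k \<le> 0"
    "\<And>i. i \<in> separable_rows A \<Longrightarrow> (A *v f i) $ i < 0"
    by metis
  define u where "u = (\<Sum>i\<in>separable_rows A. f i)"
  have u: "(A *v u) $ k = (\<Sum>i\<in>separable_rows A. (A *v f i) $ k)" for k
    by (simp add: u_def matrix_vector_row inner_sum_right)
  show ?thesis
  proof
    show neg: "(A *v u) $ i < 0" if "i \<in> separable_rows A" for i
    proof -
      have "(\<Sum>j\<in>separable_rows A. - (A *v f j) $ i) > 0"
        using f that by (intro sum_pos2 [of _ i]) auto
      then show ?thesis
        by (simp add: u sum_negf)
    qed
    have le: "(A *v u) $ k \<le> 0" for k
      unfolding u by (intro sum_nonpos f)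
    \<comment> \<open>As \<open>u\<close> increases no row, a strict decrease at \<open>i\<close>
      would make \<open>i\<close> separable.\<close>
    show "(A *v u) $ i = 0" if "i \<notin> separable_rows A" for i
      using that le unfolding separable_rows_def by (force simp: not_less intro: antisym)
  qed
qed

text \<open>This maximality of the separable rows is the hypothesis that
  \<open>loss_sum_has_minimizer\<close> uses for coercivity.\<close>

lemma ex_pos_row_if_not_separable:
  fixes A :: "real^'d^'n"
  assumes "v \<in> row_span A (- separable_rows A)" and "v \<noteq> 0"
  shows "\<exists>i\<in>- separable_rows A. (A *v v) $ i > 0"
proof (rule ccontr)
  assume "\<not> ?thesis"
  then have le: "(A *v v) $ i \<le> 0" if "i \<notin> separable_rows A" for i
    using that by (auto simp: not_less)
  obtain u where u: "\<And>i. i \<in> separable_rows A \<Longrightarrow> (A *v u) $ i < 0"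
    "\<And>i. i \<notin> separable_rows A \<Longrightarrow> (A *v u) $ i = 0"
    using separable_rows_direction [of A] by metis
  \<comment> \<open>A large multiple of \<open>u\<close> repairs the separable rows, so that \<open>v + r u\<close> would witness the
    separability of every row on which \<open>v\<close> is negative.\<close>
  have "\<forall>\<^sub>F r in at_top. \<forall>i\<in>separable_rows A. (A *v (v + r *\<^sub>R u)) $ i < 0"
    using u(1)
    by (intro eventually_ball_finite ballI filterlim_at_bot_dense [THEN iffD1, rule_format]
        matrix_vector_line_at_bot) auto
  then obtain r where r: "\<And>i. i \<in> separable_rows A \<Longrightarrow> (A *v (v + r *\<^sub>R u)) $ i < 0"
    using eventually_happens' [OF trivial_limit_at_top_linorder] by blast
  have eq: "(A *v (v + r *\<^sub>R u)) $ i = (A *v v) $ i" if "i \<notin> separable_rows A" for i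
    using u(2) [OF that] by (simp add: matrix_vector_right_distrib matrix_vector_mult_scaleR)
  then have nonpos: "(A *v (v + r *\<^sub>R u)) $ k \<le> 0" for k
    using r le by (cases "k \<in> separable_rows A") (auto intro: less_imp_le)
  have "(A *v v) $ i = 0" if "i \<notin> separable_rows A" for i
  proof (rule ccontr)
    assume "(A *v v) $ i \<noteq> 0"
    then have "(A *v (v + r *\<^sub>R u)) $ i < 0"
      using eq [OF that] le [OF that] by simp
    then show False
      using that nonpos by (auto simp: separable_rows_def)
  qed
  then have "v = 0"
    using assms(1) by (intro row_span_eq_0) auto
  then show False
    using \<open>v \<noteq> 0\<close> by simp
qed

text \<open>A single strictly increasing loss detects a misplaced row in \<open>I\<close>, and
  \<open>exp\<close> is one that satisfies all conditions of the strongly convex part.\<close>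

lemma separable_rows_eqI:
  fixes A :: "real^'d^'n"
  assumes "I \<union> J = UNIV"
    and sep: "J \<noteq> {} \<Longrightarrow> \<exists>u. \<forall>i\<in>J. (A_perp A I *v u) $ i < 0"
    and min: "is_arg_min (\<lambda>v. loss_sum exp I (A *v v)) (\<lambda>v. v \<in> row_span A I) vbar"
  shows "I = - separable_rows A" and "J = separable_rows A"
proof -
  have J: "j \<in> separable_rows A" if "j \<in> J" for j
  proof -
    obtain u where u: "\<forall>i\<in>J. (A_perp A I *v u) $ i < 0"
      using sep that by blast
    define u' where "u' = orth_proj ((row_span A I)\<^sup>\<bottom>) u"
    have u': "u' \<in> (row_span A I)\<^sup>\<bottom>"
      by (simp add: u'_def orth_proj subspace_orthogonal_comp)
    then have "(A *v u') $ i = (A_perp A I *v u) $ i" for i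
      using A_perp_mult_orth_proj [of A I u i] A_perp_mult [of u' A I i] by (simp add: u'_def)
    then have "(A *v u') $ i < 0" if "i \<in> J" for i
      using u that by simp
    moreover have "(A *v u') $ i = 0" if "i \<in> I" for i
      using u' that by (simp add: row_span_comp_iff)
    ultimately have "(A *v u') $ k \<le> 0" for k
      using \<open>I \<union> J = UNIV\<close> by (metis UNIV_I UnE less_imp_le order_refl)
    then show ?thesis
      using that \<open>\<And>i. i \<in> J \<Longrightarrow> (A *v u') $ i < 0\<close> by (auto simp: separable_rows_def)
  qed
  have I: "i \<notin> separable_rows A" if "i \<in> I" for i
  proof
    assume "i \<in> separable_rows A"
    then obtain u where u: "\<And>k. (A *v u) $ k \<le> 0" "(A *v u) $ i < 0"
      by (auto simp: separable_rows_def)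
    obtain v where v: "v \<in> row_span A I" "\<And>i. i \<in> I \<Longrightarrow> (A *v v) $ i = (A *v u) $ i"
      using row_span_component by metis
    \<comment> \<open>Replacing \<open>u\<close> by its component \<open>v\<close> keeps
      \<open>vbar + v\<close> feasible; no term of the sum grows and the one at \<open>i\<close>
      drops.\<close>
    have "loss_sum exp I (A *v (vbar + v)) < loss_sum exp I (A *v vbar)"
      unfolding loss_sum_def
      using u v that by (intro sum_strict_mono_ex1) (auto simp: matrix_vector_right_distrib)
    moreover have "vbar + v \<in> row_span A I"
      using min v(1) by (simp add: is_arg_min_def subspace_add subspace_row_span)
    ultimately show False
      using min by (auto simp: is_arg_min_def)
  qed
  show "I = - separable_rows A" and "J = separable_rows A"
    using I J \<open>I \<union> J = UNIV\<close> by auto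
qed

section \<open>Both parts for the partition into separable and remaining rows\<close>

lemma deriv_exp_real: "deriv exp = (exp :: real \<Rightarrow> real)"
  by (auto intro!: DERIV_imp_deriv DERIV_exp)

lemma twice_continuously_differentiable_exp: "twice_continuously_differentiable exp"
  by (simp add: twice_continuously_differentiable_def field_differentiable_within_exp
      continuous_on_exp deriv_exp_real)

lemma strongly_convex_part:
  fixes A :: "real^'d^'n"
  defines "I \<equiv> - separable_rows A"
  assumes l: "twice_continuously_differentiable l" "\<And>z. deriv (deriv l) z > 0"
    "\<And>z. l z \<ge> 0" "(l \<longlongrightarrow> 0) at_bot"
  shows "compact D \<Longrightarrow> D \<subseteq> row_span A I \<Longrightarrow>
      strongly_convex_over D (\<lambda>w. loss_sum l UNIV (A *v w))"
    and "\<exists>vbar.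
      unique_arg_min (\<lambda>v. loss_sum l I (A *v v)) (\<lambda>v. v \<in> row_span A I) vbar \<and>
      (INF w. loss_sum l UNIV (A *v w)) = (INF v\<in>row_span A I. loss_sum l I (A *v v)) \<and>
      (INF v\<in>row_span A I. loss_sum l I (A *v v)) = loss_sum l I (A *v vbar)"
proof -
  show "strongly_convex_over D (\<lambda>w. loss_sum l UNIV (A *v w))"
    if "compact D" "D \<subseteq> row_span A I"
  proof (rule strongly_convex_loss_sum [OF l(1,2) subspace_row_span _ that])
    show "v = 0" if "v \<in> row_span A I" "\<And>i. i \<in> UNIV \<Longrightarrow> (A *v v) $ i = 0" for v
      using that by (intro row_span_eq_0 [of v A I]) auto
  qed
  have "\<exists>vbar. is_arg_min (\<lambda>v. loss_sum l I (A *v v)) (\<lambda>v. v \<in> row_span A I) vbar"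
    using ex_pos_row_if_not_separable unfolding I_def
    by (intro loss_sum_has_minimizer [OF l subspace_row_span]) blast
  then obtain vbar
    where min: "is_arg_min (\<lambda>v. loss_sum l I (A *v v)) (\<lambda>v. v \<in> row_span A I) vbar"
    by blast
  have unique: "unique_arg_min (\<lambda>v. loss_sum l I (A *v v)) (\<lambda>v. v \<in> row_span A I) vbar"
    unfolding unique_arg_min_def
    using min loss_sum_minimizer_unique [OF l(1,2) _ min] by blast
  obtain u where "\<And>i. i \<in> I \<Longrightarrow> (A *v u) $ i = 0" "\<And>i. i \<in> - I \<Longrightarrow> (A *v u) $ i < 0"
    using separable_rows_direction [of A] unfolding I_def by (metis ComplD double_complement)
  then have "(INF w. loss_sum l UNIV (A *v w)) = loss_sum l I (A *v vbar)"
    using INF_loss_sum_UNIV [OF l(3,4) _ _ min] by metis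
  then show "\<exists>vbar.
      unique_arg_min (\<lambda>v. loss_sum l I (A *v v)) (\<lambda>v. v \<in> row_span A I) vbar \<and>
      (INF w. loss_sum l UNIV (A *v w)) = (INF v\<in>row_span A I. loss_sum l I (A *v v)) \<and>
      (INF v\<in>row_span A I. loss_sum l I (A *v v)) = loss_sum l I (A *v vbar)"
    using INF_loss_sum_row_span [OF min] unique by (intro exI [of _ vbar]) simp
qed

text \<open>Duality is applied to \<open>A_perp\<close>. A dual optimum exhibits \<open>ubar\<close>
  as an element of the complement, so \<open>ubar\<close> vanishes on the rows in \<open>I\<close>
  and is at most \<open>- \<gamma>\<close> on those in \<open>J\<close>; it can therefore serve as
  the direction along which the infimum is approached.\<close>

lemma separable_part:
  fixes A :: "real^'d^'n"
  defines "J \<equiv> separable_rows A"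
  defines "I \<equiv> - J"
  assumes "J \<noteq> {}"
  shows "\<exists>u. \<forall>i\<in>J. (A_perp A I *v u) $ i < 0"
    and "\<exists>\<gamma> ubar.
        unique_arg_min (\<lambda>u. max_coord J (A_perp A I *v u)) (\<lambda>u. norm u = 1) ubar \<and>
        \<gamma> = - max_coord J (A_perp A I *v ubar) \<and>
        (\<exists>q. is_arg_min (\<lambda>q. norm (transpose (A_perp A I) *v q)) (\<lambda>q. q \<in> prob_simplex J) q \<and>
          \<gamma> = norm (transpose (A_perp A I) *v q)) \<and>
        \<gamma> > 0 \<and>
        (\<forall>qbar. is_arg_min (\<lambda>q. norm (transpose (A_perp A I) *v q)) (\<lambda>q. q \<in> prob_simplex J) qbar
          \<longrightarrow> ubar = - ((1 / \<gamma>) *\<^sub>R (transpose (A_perp A I) *v qbar))) \<and>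
        (\<forall>(l :: real \<Rightarrow> real) vbar.
          (\<forall>z. l z \<ge> 0) \<and> (l \<longlongrightarrow> 0) at_bot \<and>
          is_arg_min (\<lambda>v. loss_sum l I (A *v v)) (\<lambda>v. v \<in> row_span A I) vbar \<longrightarrow>
            (\<exists>m. ((\<lambda>r. loss_sum l J (A *v (vbar + r *\<^sub>R ubar))) \<longlongrightarrow> m) at_top \<and>
              (INF w. loss_sum l UNIV (A *v w)) = loss_sum l I (A *v vbar) + m \<and>
              loss_sum l I (A *v vbar) + m = loss_sum l I (A *v vbar)))"
proof -
  obtain u where u: "\<And>i. i \<in> J \<Longrightarrow> (A *v u) $ i < 0" "\<And>i. i \<in> I \<Longrightarrow> (A *v u) $ i = 0"
    using separable_rows_direction [of A] unfolding I_def J_def by (metis ComplD)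
  then have "u \<in> (row_span A I)\<^sup>\<bottom>"
    by (simp add: row_span_comp_iff)
  then have sep: "(A_perp A I *v u) $ i < 0" if "i \<in> J" for i
    using u that by (simp add: A_perp_mult)
  then show "\<exists>u. \<forall>i\<in>J. (A_perp A I *v u) $ i < 0"
    by blast
  obtain \<gamma> ubar where "\<gamma> > 0"
    and dual: "\<exists>q. is_arg_min (\<lambda>q. norm (transpose (A_perp A I) *v q)) (\<lambda>q. q \<in> prob_simplex J) q"
    and primal: "unique_arg_min (\<lambda>u. max_coord J (A_perp A I *v u)) (\<lambda>u. norm u = 1) ubar"
    and \<gamma>: "\<gamma> = - max_coord J (A_perp A I *v ubar)"
    and norm_dual: "\<And>q. is_arg_min (\<lambda>q. norm (transpose (A_perp A I) *v q)) (\<lambda>q. q \<in> prob_simplex J) q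
      \<Longrightarrow> norm (transpose (A_perp A I) *v q) = \<gamma>"
    and ubar: "\<And>q. is_arg_min (\<lambda>q. norm (transpose (A_perp A I) *v q)) (\<lambda>q. q \<in> prob_simplex J) q
      \<Longrightarrow> ubar = - ((1 / \<gamma>) *\<^sub>R (transpose (A_perp A I) *v q))"
    by (rule max_margin_duality [OF \<open>J \<noteq> {}\<close> sep]) (assumption, (rule that; assumption))
  obtain q where "ubar = - ((1 / \<gamma>) *\<^sub>R (transpose (A_perp A I) *v q))"
    using dual ubar by blast
  then have perp: "ubar \<in> (row_span A I)\<^sup>\<bottom>"
    using transpose_A_perp_mult [of A I q]
    by (metis subspace_neg subspace_orthogonal_comp subspace_scale)
  then have zero: "(A *v ubar) $ i = 0" if "i \<in> I" for i
    using that by (simp add: row_span_comp_iff)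
  have neg: "(A *v ubar) $ i < 0" if "i \<in> J" for i
  proof -
    have "(A *v ubar) $ i \<le> max_coord J (A_perp A I *v ubar)"
      using that perp by (simp add: max_coord_def flip: A_perp_mult)
    then show ?thesis
      using \<gamma> \<open>\<gamma> > 0\<close> by simp
  qed
  have "((\<lambda>r. loss_sum l J (A *v (vbar + r *\<^sub>R ubar))) \<longlongrightarrow> 0) at_top"
    and "(INF w. loss_sum l UNIV (A *v w)) = loss_sum l I (A *v vbar)"
    if "\<forall>z. l z \<ge> 0" "(l \<longlongrightarrow> 0) at_bot"
      "is_arg_min (\<lambda>v. loss_sum l I (A *v v)) (\<lambda>v. v \<in> row_span A I) vbar" for l vbar
    using that neg zero
    by (auto intro!: loss_sum_line_tendsto_0 INF_loss_sum_UNIV [where u = ubar] simp: I_def)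
  then have "\<forall>(l :: real \<Rightarrow> real) vbar.
      (\<forall>z. l z \<ge> 0) \<and> (l \<longlongrightarrow> 0) at_bot \<and>
      is_arg_min (\<lambda>v. loss_sum l I (A *v v)) (\<lambda>v. v \<in> row_span A I) vbar \<longrightarrow>
        (\<exists>m. ((\<lambda>r. loss_sum l J (A *v (vbar + r *\<^sub>R ubar))) \<longlongrightarrow> m) at_top \<and>
          (INF w. loss_sum l UNIV (A *v w)) = loss_sum l I (A *v vbar) + m \<and>
          loss_sum l I (A *v vbar) + m = loss_sum l I (A *v vbar))"
    \<comment> \<open>The limit \<open>m\<close> of the loss on \<open>J\<close> is 0.\<close>
    by (intro allI impI exI [of _ 0]) simp
  moreover have "\<exists>q. is_arg_min (\<lambda>q. norm (transpose (A_perp A I) *v q)) (\<lambda>q. q \<in> prob_simplex J) q \<and>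
      \<gamma> = norm (transpose (A_perp A I) *v q)"
    using dual norm_dual by blast
  moreover have "\<forall>q. is_arg_min (\<lambda>q. norm (transpose (A_perp A I) *v q)) (\<lambda>q. q \<in> prob_simplex J) q
      \<longrightarrow> ubar = - ((1 / \<gamma>) *\<^sub>R (transpose (A_perp A I) *v q))"
    using ubar by blast
  ultimately show "\<exists>\<gamma> ubar.
        unique_arg_min (\<lambda>u. max_coord J (A_perp A I *v u)) (\<lambda>u. norm u = 1) ubar \<and>
        \<gamma> = - max_coord J (A_perp A I *v ubar) \<and>
        (\<exists>q. is_arg_min (\<lambda>q. norm (transpose (A_perp A I) *v q)) (\<lambda>q. q \<in> prob_simplex J) q \<and>
          \<gamma> = norm (transpose (A_perp A I) *v q)) \<and>
        \<gamma> > 0 \<and>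
        (\<forall>qbar. is_arg_min (\<lambda>q. norm (transpose (A_perp A I) *v q)) (\<lambda>q. q \<in> prob_simplex J) qbar
          \<longrightarrow> ubar = - ((1 / \<gamma>) *\<^sub>R (transpose (A_perp A I) *v qbar))) \<and>
        (\<forall>(l :: real \<Rightarrow> real) vbar.
          (\<forall>z. l z \<ge> 0) \<and> (l \<longlongrightarrow> 0) at_bot \<and>
          is_arg_min (\<lambda>v. loss_sum l I (A *v v)) (\<lambda>v. v \<in> row_span A I) vbar \<longrightarrow>
            (\<exists>m. ((\<lambda>r. loss_sum l J (A *v (vbar + r *\<^sub>R ubar))) \<longlongrightarrow> m) at_top \<and>
              (INF w. loss_sum l UNIV (A *v w)) = loss_sum l I (A *v vbar) + m \<and>
              loss_sum l I (A *v vbar) + m = loss_sum l I (A *v vbar)))"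
    using primal \<gamma> \<open>\<gamma> > 0\<close> by (intro exI [of _ \<gamma>] exI [of _ ubar] conjI)
qed

theorem theorem2p1:
  fixes A :: "real^'d^'n"
  assumes normalized: "\<forall>i. norm (row i A) \<le> 1"
  shows "\<exists>!(I, J).
    I \<union> J = UNIV \<and> I \<inter> J = {} \<and>
    (\<forall>l :: real \<Rightarrow> real.
      twice_continuously_differentiable l \<and> (\<forall>z. deriv (deriv l) z > 0) \<and>
      (\<forall>z. l z \<ge> 0) \<and> (l \<longlongrightarrow> 0) at_bot \<longrightarrow>
        (\<forall>D. compact D \<and> D \<subseteq> row_span A I \<longrightarrow>
          strongly_convex_over D (\<lambda>w. loss_sum l UNIV (A *v w))) \<and>
        (\<exists>vbar.
          unique_arg_min (\<lambda>v. loss_sum l I (A *v v)) (\<lambda>v. v \<in> row_span A I) vbar \<and>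
          (INF w. loss_sum l UNIV (A *v w)) = (INF v\<in>row_span A I. loss_sum l I (A *v v)) \<and>
          (INF v\<in>row_span A I. loss_sum l I (A *v v)) = loss_sum l I (A *v vbar))) \<and>
    (J \<noteq> {} \<longrightarrow>
      (\<exists>u. \<forall>i\<in>J. (A_perp A I *v u) $ i < 0) \<and>
      (\<exists>\<gamma> ubar.
        unique_arg_min (\<lambda>u. max_coord J (A_perp A I *v u)) (\<lambda>u. norm u = 1) ubar \<and>
        \<gamma> = - max_coord J (A_perp A I *v ubar) \<and>
        (\<exists>q. is_arg_min (\<lambda>q. norm (transpose (A_perp A I) *v q)) (\<lambda>q. q \<in> prob_simplex J) q \<and>
          \<gamma> = norm (transpose (A_perp A I) *v q)) \<and>
        \<gamma> > 0 \<and>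
        (\<forall>qbar. is_arg_min (\<lambda>q. norm (transpose (A_perp A I) *v q)) (\<lambda>q. q \<in> prob_simplex J) qbar
          \<longrightarrow> ubar = - ((1 / \<gamma>) *\<^sub>R (transpose (A_perp A I) *v qbar))) \<and>
        (\<forall>(l :: real \<Rightarrow> real) vbar.
          (\<forall>z. l z \<ge> 0) \<and> (l \<longlongrightarrow> 0) at_bot \<and>
          is_arg_min (\<lambda>v. loss_sum l I (A *v v)) (\<lambda>v. v \<in> row_span A I) vbar \<longrightarrow>
            (\<exists>m. ((\<lambda>r. loss_sum l J (A *v (vbar + r *\<^sub>R ubar))) \<longlongrightarrow> m) at_top \<and>
              (INF w. loss_sum l UNIV (A *v w)) = loss_sum l I (A *v vbar) + m \<and>
              loss_sum l I (A *v vbar) + m = loss_sum l I (A *v vbar)))))"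
proof (rule ex1I [of _ "(- separable_rows A, separable_rows A)"], goal_cases)
  case 1
  show ?case
    unfolding prod.case
    by (intro conjI allI impI; (elim conjE)?;
        ((rule separable_part, assumption) | (rule strongly_convex_part; blast) | simp))
next
  case (2 IJ)
  obtain I J where IJ: "IJ = (I, J)"
    by fastforce
  note * = 2 [unfolded IJ prod.case]
  \<comment> \<open>The property for all losses is instantiated with \<open>exp\<close> to obtain
    the minimizer that \<open>separable_rows_eqI\<close> expects.\<close>
  have "\<exists>vbar. is_arg_min (\<lambda>v. loss_sum exp I (A *v v)) (\<lambda>v. v \<in> row_span A I) vbar"
    using * [THEN conjunct2, THEN conjunct2, THEN conjunct1, rule_format, of exp]
    by (auto simp: twice_continuously_differentiable_exp deriv_exp_real exp_at_bot unique_arg_min_def)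
  then show ?case
    using * separable_rows_eqI [of I J A] by (auto simp: IJ)
qed

end
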